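(* Let $\mathcal{X},\mathcal{Y}$ be finite alphabets. For any joint distribution $P_{XY}$ on $\mathcal{X}\times\mathcal{Y}$ and any positive integer $k$, $$\mathcal{L}^{(k)}(X\to Y)=\mathcal{L}(X\to Y).$$
   Context: $\log$ is the natural logarithm. Dashes denote Markov chains. The maximal leakage is $$\mathcal{L}(X\to Y)=\sup_{U-X-Y-\hat U}\log\frac{\Pr(U=\hat U)}{\max_{u}P_U(u)},$$ the supremum being over all $U,\hat U$ taking values in the same finite, but arbitrary, alphabet. For a positive integer $k$, the $k$-maximal leakage is $$\mathcal{L}^{(k)}(X\to Y)=\sup_{U-X-Y-(\hat U_i)_{i=1}^k}\log\frac{\Pr\left(\bigvee_{i=1}^k\{U=\hat U_i\}\right)}{\max_{S\subseteq\mathcal{U},\,|S|\le k}P_U(S)},$$ where $U$ takes values in a finite, but arbitrary, alphabet $\mathcal{U}$, and $\hat U_1,\dots,\hat U_k$ are $\mathcal{U}$-valued guesses. *)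

theory Defs
  imports "HOL-Probability.Probability"
begin

text \<open>Extended-real natural logarithm of a nonnegative number; \<open>ln 0 = 0\<close> in the library, whereas
  here \<open>log 0 = -\<infinity>\<close>.\<close>

definition elog :: "real \<Rightarrow> ereal" where
  "elog r = (if r \<le> 0 then - \<infinity> else ereal (ln r))"

text \<open>\<open>f\<close> and \<open>g\<close> are conditionally independent given \<open>h\<close>. For values \<open>c\<close> that \<open>h\<close> takes with
  probability 0 the equation reads \<open>0 = 0 * 0\<close>, as \<open>cond_prob\<close> is then 0.\<close>

definition cond_indep :: "'w pmf \<Rightarrow> ('w \<Rightarrow> 'a) \<Rightarrow> ('w \<Rightarrow> 'b) \<Rightarrow> ('w \<Rightarrow> 'c) \<Rightarrow> bool" where
  "cond_indep J f g h \<longleftrightarrow>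
     (\<forall>a b c. \<P>(w in measure_pmf J. f w = a \<and> g w = b \<bar> h w = c) =
       \<P>(w in measure_pmf J. f w = a \<bar> h w = c) * \<P>(w in measure_pmf J. g w = b \<bar> h w = c))"

text \<open>\<open>J\<close> is the joint law of a Markov chain \<open>U - X - Y - V\<close>: given the present, the future
  is independent of the past, both at \<open>X\<close> and at \<open>Y\<close>.\<close>

definition markov_chain :: "('u \<times> 'x \<times> 'y \<times> 'v) pmf \<Rightarrow> bool" where
  "markov_chain J \<longleftrightarrow>
     cond_indep J (\<lambda>(u, x, y, v). u) (\<lambda>(u, x, y, v). (y, v)) (\<lambda>(u, x, y, v). x) \<and>
     cond_indep J (\<lambda>(u, x, y, v). (u, x)) (\<lambda>(u, x, y, v). v) (\<lambda>(u, x, y, v). y)"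

text \<open>The joint laws of \<open>U - X - Y - V\<close> with \<open>(X, Y) \<sim> P\<close>, \<open>U\<close> valued in \<open>A\<close> and \<open>V\<close> valued
  in \<open>G\<close>. Every finite alphabet is in bijection with a finite set of natural numbers, so it
  suffices to let the alphabet \<open>A\<close> range over those.\<close>

definition attack_laws ::
    "('x \<times> 'y) pmf \<Rightarrow> nat set \<Rightarrow> 'v set \<Rightarrow> (nat \<times> 'x \<times> 'y \<times> 'v) pmf set" where
  "attack_laws P A G =
     {J. markov_chain J \<and> map_pmf (\<lambda>(u, x, y, v). (x, y)) J = P \<and>
         set_pmf J \<subseteq> A \<times> UNIV \<times> UNIV \<times> G}"

definition maximal_leakage :: "('x \<times> 'y) pmf \<Rightarrow> ereal" where
  "maximal_leakage P =
     (SUP (A, J) \<in> {(A, J). finite A \<and> J \<in> attack_laws P A A}.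
        elog (\<P>(w in measure_pmf J. case w of (u, x, y, v) \<Rightarrow> u = v) /
              Max ((\<lambda>u. pmf (map_pmf fst J) u) ` A)))"

definition k_maximal_leakage :: "nat \<Rightarrow> ('x \<times> 'y) pmf \<Rightarrow> ereal" where
  "k_maximal_leakage k P =
     (SUP (A, J) \<in> {(A, J). finite A \<and> J \<in> attack_laws P A ({1..k} \<rightarrow>\<^sub>E A)}.
        elog (\<P>(w in measure_pmf J. case w of (u, x, y, v) \<Rightarrow> \<exists>i\<in>{1..k}. u = v i) /
              Max ((\<lambda>S. measure_pmf.prob (map_pmf fst J) S) ` {S. S \<subseteq> A \<and> card S \<le> k})))"

end

theory Submission
  imports Defs
begin

text \<open>Both leakages equal \<open>log (\<Sum>y. max x. P(y | x))\<close>. For the upper bound, the Markov property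
  gives \<open>Pr(U \<in> S, Y = y) = (\<Sum>x. Pr(U \<in> S, X = x) P(y | x)) \<le> Pr(U \<in> S) max x. P(y | x)\<close>, so
  the best set \<open>S\<close> of \<open>k\<close> guesses gains at most the factor \<open>\<Sum>y. max x. P(y | x)\<close> over blind
  guessing. Conversely, a secret \<open>U\<close> for which every \<open>x\<close> owns \<open>k\<close> equally likely values that are
  modes of \<open>U\<close> attains the bound: on seeing \<open>y\<close>, guess the \<open>k\<close> values owned by a maximizer of
  \<open>P(y | x)\<close>.\<close>

section \<open>Finite decompositions of events and conditional independence\<close>

lemma elog_mono: "r \<le> s \<Longrightarrow> elog r \<le> elog s"
  by (auto simp: elog_def)

text \<open>Only points of the support have to be mapped into \<open>T\<close>, so the alphabets
  imposed by \<open>attack_laws\<close> provide a finite \<open>T\<close> even though the underlying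
  types are infinite.\<close>

lemma measure_pmf_eq_sum_fibres:
  assumes "finite T" and "\<And>w. w \<in> set_pmf J \<Longrightarrow> w \<in> E \<Longrightarrow> h w \<in> T"
  shows "measure_pmf.prob J E = (\<Sum>t\<in>T. measure_pmf.prob J {w \<in> E. h w = t})"
proof -
  have "measure_pmf.prob J E = measure_pmf.prob J (\<Union>t\<in>T. {w \<in> E. h w = t})"
    using assms(2) by (intro measure_eq_AE) (auto simp: AE_measure_pmf_iff)
  also have "\<dots> = (\<Sum>t\<in>T. measure_pmf.prob J {w \<in> E. h w = t})"
    using assms(1)
    by (intro measure_pmf.finite_measure_finite_Union) (auto simp: disjoint_family_on_def)
  finally show ?thesis .
qed

text \<open>Clearing denominators is harmless: where \<open>h w = c\<close> has probability 0, the
  conditional probabilities are 0 by convention and the joint ones by monotonicity, so both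
  equations read 0 = 0.\<close>

lemma cond_indep_iff:
  "cond_indep J f g h \<longleftrightarrow>
    (\<forall>a b c. measure_pmf.prob J {w. f w = a \<and> g w = b \<and> h w = c} * measure_pmf.prob J {w. h w = c} =
       measure_pmf.prob J {w. f w = a \<and> h w = c} * measure_pmf.prob J {w. g w = b \<and> h w = c})"
proof -
  have "\<P>(w in measure_pmf J. f w = a \<and> g w = b \<bar> h w = c) =
       \<P>(w in measure_pmf J. f w = a \<bar> h w = c) * \<P>(w in measure_pmf J. g w = b \<bar> h w = c)
     \<longleftrightarrow> measure_pmf.prob J {w. f w = a \<and> g w = b \<and> h w = c} * measure_pmf.prob J {w. h w = c} =
       measure_pmf.prob J {w. f w = a \<and> h w = c} * measure_pmf.prob J {w. g w = b \<and> h w = c}"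
    for a b c
  proof (cases "measure_pmf.prob J {w. h w = c} = 0")
    case True
    have "measure_pmf.prob J {w. f w = a \<and> h w = c} \<le> measure_pmf.prob J {w. h w = c}"
      by (intro measure_pmf.finite_measure_mono) auto
    with True have "measure_pmf.prob J {w. f w = a \<and> h w = c} = 0"
      by (simp add: measure_le_0_iff)
    with True show ?thesis
      by (simp add: cond_prob_def)
  next
    case False
    then show ?thesis
      by (simp add: cond_prob_def field_simps conj_assoc)
  qed
  then show ?thesis
    by (simp add: cond_indep_def)
qed

text \<open>Both sides are additive in the event on \<open>f\<close>. This serves to treat a whole
  set of guesses as one event, and to sum out a coordinate of \<open>f\<close>.\<close>

lemma cond_indep_finite_set:
  assumes "cond_indep J f g h" and "finite S"
  shows "measure_pmf.prob J {w. f w \<in> S \<and> g w = b \<and> h w = c} * measure_pmf.prob J {w. h w = c} =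
    measure_pmf.prob J {w. f w \<in> S \<and> h w = c} * measure_pmf.prob J {w. g w = b \<and> h w = c}"
proof -
  have 1: "measure_pmf.prob J {w. f w \<in> S \<and> g w = b \<and> h w = c} =
      (\<Sum>a\<in>S. measure_pmf.prob J {w. f w = a \<and> g w = b \<and> h w = c})"
    by (subst measure_pmf_eq_sum_fibres[where h = f and T = S])
      (use assms(2) in \<open>auto intro!: sum.cong arg_cong[where f = "measure_pmf.prob J"]\<close>)
  have 2: "measure_pmf.prob J {w. f w \<in> S \<and> h w = c} =
      (\<Sum>a\<in>S. measure_pmf.prob J {w. f w = a \<and> h w = c})"
    by (subst measure_pmf_eq_sum_fibres[where h = f and T = S])
      (use assms(2) in \<open>auto intro!: sum.cong arg_cong[where f = "measure_pmf.prob J"]\<close>)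
  show ?thesis
    using assms(1) unfolding 1 2 sum_distrib_right cond_indep_iff
    by (intro sum.cong) auto
qed

section \<open>The upper bound on the success probability\<close>

text \<open>For \<open>x\<close> outside the support of \<open>X\<close> the quotient is \<open>0 / 0 = 0\<close>, so the maximum is
  effectively over the support, and the sum is \<open>\<Sum>y. max x. P(y | x)\<close>.\<close>

definition channel_max :: "('x::finite \<times> 'y::finite) pmf \<Rightarrow> 'y \<Rightarrow> real" where
  "channel_max P y = (MAX x. pmf P (x, y) / pmf (map_pmf fst P) x)"

text \<open>Its logarithm is the Sibson mutual information of order infinity.\<close>

definition sum_channel_max :: "('x::finite \<times> 'y::finite) pmf \<Rightarrow> real" where
  "sum_channel_max P = (\<Sum>y\<in>UNIV. channel_max P y)"

lemma channel_max_ge: "pmf P (x, y) / pmf (map_pmf fst P) x \<le> channel_max P y"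
  unfolding channel_max_def by (intro Max_ge) auto

lemma channel_max_nonneg: "0 \<le> channel_max P y"
  by (rule order_trans[OF _ channel_max_ge[of P undefined]]) simp

lemma sum_channel_max_nonneg: "0 \<le> sum_channel_max P"
  unfolding sum_channel_max_def by (intro sum_nonneg channel_max_nonneg)

text \<open>One bound serves both leakages: \<open>W v\<close> is the set of values that the guess
  \<open>v\<close> covers, and \<open>m\<close> bounds the mass of such a set under blind guessing.
  The success event is cut into cells indexed by (y, v, x), and each cell is estimated by the Markov
  property.\<close>

lemma attack_success_le:
  fixes P :: "('x::finite \<times> 'y::finite) pmf" and W :: "'v \<Rightarrow> nat set"
  assumes J: "J \<in> attack_laws P A G" and "finite A" "finite G"
    and W: "\<And>v. v \<in> G \<Longrightarrow> finite (W v)"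
    and m: "\<And>v. v \<in> G \<Longrightarrow> measure_pmf.prob (map_pmf fst J) (W v) \<le> m"
  shows "measure_pmf.prob J {(u, x, y, v). u \<in> W v} \<le> m * sum_channel_max P"
proof -
  let ?X = "\<lambda>(u, x, y, v). x" and ?Y = "\<lambda>(u, x, y, v). y" and ?V = "\<lambda>(u, x, y, v). v"
  define pY where "pY y = measure_pmf.prob J {w. ?Y w = y}" for y
  define pYV where "pYV y v = measure_pmf.prob J {w. ?Y w = y \<and> ?V w = v}" for y v
  define pUX where "pUX v x = measure_pmf.prob J {w. fst w \<in> W v \<and> ?X w = x}" for v x
  have supp: "set_pmf J \<subseteq> A \<times> UNIV \<times> UNIV \<times> G" and P: "map_pmf (\<lambda>(u, x, y, v). (x, y)) J = P"
    and M1: "cond_indep J (\<lambda>(u, x, y, v). u) (\<lambda>(u, x, y, v). (y, v)) (\<lambda>(u, x, y, v). x)"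
    and M2: "cond_indep J (\<lambda>(u, x, y, v). (u, x)) (\<lambda>(u, x, y, v). v) (\<lambda>(u, x, y, v). y)"
    using J by (auto simp: attack_laws_def markov_chain_def)
  have pXY: "measure_pmf.prob J {w. ?X w = x \<and> ?Y w = y} = pmf P (x, y)" for x y
    unfolding P[symmetric] pmf_map
    by (auto intro!: arg_cong[where f = "measure_pmf.prob J"])
  have pX: "measure_pmf.prob J {w. ?X w = x} = pmf (map_pmf fst P) x" for x
    unfolding P[symmetric] map_pmf_comp pmf_map
    by (auto intro!: arg_cong[where f = "measure_pmf.prob J"])
  \<comment> \<open>The chain factorizes the cell as P(U \<in> W v, X = x) P(y | x) P(v | y), and
    P(y | x) is then replaced by its maximum. Dividing by the masses of x and y is legitimate once
    (x, y) has positive mass; otherwise the cell is null.\<close>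
  have pt: "measure_pmf.prob J {(u', x', y', v'). u' \<in> W v \<and> x' = x \<and> y' = y \<and> v' = v}
      \<le> pUX v x * channel_max P y * (pYV y v / pY y)" (is "?L \<le> _")
    if v: "v \<in> G" for x y v
  proof (cases "pmf P (x, y) = 0")
    case True
    have "?L \<le> measure_pmf.prob J {w. ?X w = x \<and> ?Y w = y}"
      by (intro measure_pmf.finite_measure_mono) auto
    with True pXY have "?L \<le> 0" by simp
    also have "0 \<le> pUX v x * channel_max P y * (pYV y v / pY y)"
      by (simp add: pUX_def pYV_def pY_def channel_max_nonneg)
    finally show ?thesis .
  next
    case False
    let ?pXYV = "measure_pmf.prob J {w. ?X w = x \<and> ?Y w = y \<and> ?V w = v}"
    have "pmf P (x, y) \<le> pmf (map_pmf fst P) x"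
      unfolding pX[symmetric] pXY[symmetric] by (intro measure_pmf.finite_measure_mono) auto
    with False have px: "pmf (map_pmf fst P) x > 0"
      by (metis antisym_conv2 order_less_le_trans pmf_nonneg)
    have "pmf P (x, y) \<le> pY y"
      unfolding pY_def pXY[symmetric] by (intro measure_pmf.finite_measure_mono) auto
    with False have py: "pY y > 0"
      by (metis antisym_conv2 order_less_le_trans pmf_nonneg)
    have 1: "?L * pmf (map_pmf fst P) x = pUX v x * ?pXYV"
      using cond_indep_finite_set[OF M1 W[OF v], where b = "(y, v)" and c = x]
      unfolding pX[symmetric] pUX_def
      by (simp add: case_prod_unfold prod_eq_iff conj_ac)
    \<comment> \<open>The second Markov condition speaks of the pair (U, X). Since U lies in
      \<open>A\<close> almost surely, the set \<open>A \<times> {x}\<close> sums U out and leaves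
      the condition X = x.\<close>
    have "measure_pmf.prob J
          {w. (\<lambda>(u, x, y, v). (u, x)) w \<in> A \<times> {x} \<and> ?V w = v \<and> ?Y w = y} = ?pXYV"
      using supp by (intro measure_eq_AE) (auto simp: AE_measure_pmf_iff)
    moreover have "measure_pmf.prob J {w. (\<lambda>(u, x, y, v). (u, x)) w \<in> A \<times> {x} \<and> ?Y w = y}
        = pmf P (x, y)"
      unfolding pXY[symmetric]
      using supp by (intro measure_eq_AE) (auto simp: AE_measure_pmf_iff)
    ultimately have 2: "?pXYV * pY y = pmf P (x, y) * pYV y v"
      using cond_indep_finite_set[OF M2, where S = "A \<times> {x}" and b = v and c = y] \<open>finite A\<close>
      unfolding pY_def pYV_def by (simp add: conj_ac)
    have "?L = pUX v x * ?pXYV / pmf (map_pmf fst P) x"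
      using 1 px by (simp add: field_simps)
    also have "?pXYV = pmf P (x, y) * pYV y v / pY y"
      using 2 py by (simp add: field_simps)
    also have "pUX v x * (pmf P (x, y) * pYV y v / pY y) / pmf (map_pmf fst P) x =
        pUX v x * (pmf P (x, y) / pmf (map_pmf fst P) x) * (pYV y v / pY y)"
      by (simp add: mult_ac)
    also have "\<dots> \<le> pUX v x * channel_max P y * (pYV y v / pY y)"
      by (intro mult_right_mono mult_left_mono channel_max_ge)
        (auto simp: pUX_def pYV_def pY_def)
    finally show ?thesis .
  qed
  have pU: "(\<Sum>x\<in>UNIV. pUX v x) \<le> m" if "v \<in> G" for v
  proof -
    have "(\<Sum>x\<in>UNIV. pUX v x) = measure_pmf.prob J {w. fst w \<in> W v}"
      unfolding pUX_def by (subst measure_pmf_eq_sum_fibres[where h = ?X and T = UNIV]) auto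
    also have "\<dots> = measure_pmf.prob (map_pmf fst J) (W v)"
      by (simp add: vimage_def)
    finally show ?thesis using m[OF that] by simp
  qed
  have pV: "(\<Sum>v\<in>G. pYV y v) = pY y" for y
    unfolding pYV_def pY_def
    by (subst measure_pmf_eq_sum_fibres[where h = ?V and T = G and E = "{w. ?Y w = y}"])
      (use \<open>finite G\<close> supp in auto)
  have "m \<ge> 0"
  proof -
    obtain w where "w \<in> set_pmf J" using set_pmf_not_empty[of J] by blast
    then obtain v where "v \<in> G" using supp by (cases w) auto
    from m[OF this] show ?thesis by (rule order_trans[rotated]) simp
  qed
  have "measure_pmf.prob J {(u, x, y, v). u \<in> W v} =
      (\<Sum>(y, v, x)\<in>UNIV \<times> G \<times> UNIV.
        measure_pmf.prob J {(u', x', y', v'). u' \<in> W v \<and> x' = x \<and> y' = y \<and> v' = v})"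
    by (subst measure_pmf_eq_sum_fibres[where h = "\<lambda>(u, x, y, v). (y, v, x)" and T = "UNIV \<times> G \<times> UNIV"])
      (use \<open>finite G\<close> supp in \<open>auto intro!: sum.cong arg_cong[where f = "measure_pmf.prob J"]\<close>)
  also have "\<dots> \<le> (\<Sum>(y, v, x)\<in>UNIV \<times> G \<times> UNIV. pUX v x * channel_max P y * (pYV y v / pY y))"
    using pt by (intro sum_mono) auto
  \<comment> \<open>With P(y | x) gone, x occurs in \<open>pUX\<close> alone, and its sum is the
    mass of \<open>W v\<close>, at most \<open>m\<close>.\<close>
  also have "\<dots> = (\<Sum>y\<in>UNIV. \<Sum>v\<in>G. (\<Sum>x\<in>UNIV. pUX v x) * channel_max P y * (pYV y v / pY y))"
    by (simp add: sum.cartesian_product' sum_distrib_right flip: sum_divide_distrib)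
  also have "\<dots> \<le> (\<Sum>y\<in>UNIV. \<Sum>v\<in>G. m * channel_max P y * (pYV y v / pY y))"
    by (intro sum_mono mult_right_mono pU)
      (auto simp: pYV_def pY_def channel_max_nonneg)
  also have "\<dots> = (\<Sum>y\<in>UNIV. m * channel_max P y * (pY y / pY y))"
    by (simp only: pV flip: sum_distrib_left sum_divide_distrib)
  \<comment> \<open>The quotient \<open>pY y / pY y\<close> is 0 rather than 1 when y has
    probability 0, hence an inequality, which rests on \<open>m \<ge> 0\<close>.\<close>
  also have "\<dots> \<le> (\<Sum>y\<in>UNIV. m * channel_max P y)"
    using \<open>m \<ge> 0\<close> by (intro sum_mono) (auto simp: channel_max_nonneg)
  also have "\<dots> = m * sum_channel_max P"
    by (simp add: sum_channel_max_def sum_distrib_left)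
  finally show ?thesis .
qed

section \<open>Attacks given by a kernel and a guessing function\<close>

text \<open>Guesses that are a deterministic function of Y suffice to attain the bound, so only the
  secret is drawn from a kernel.\<close>

definition attack ::
    "('x \<times> 'y) pmf \<Rightarrow> ('x \<Rightarrow> nat pmf) \<Rightarrow> ('y \<Rightarrow> 'v) \<Rightarrow> (nat \<times> 'x \<times> 'y \<times> 'v) pmf" where
  "attack P K g = bind_pmf P (\<lambda>(x, y). map_pmf (\<lambda>u. (u, x, y, g y)) (K x))"

lemma map_fst_attack: "map_pmf fst (attack P K g) = bind_pmf P (\<lambda>(x, y). K x)"
  by (simp add: attack_def map_bind_pmf case_prod_unfold map_pmf_comp)

lemma measure_bind_pmf:
  "measure_pmf.prob (bind_pmf M f) E = (\<integral>x. measure_pmf.prob (f x) E \<partial>measure_pmf M)"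
  using measurable_measure_pmf[of f] unfolding measure_pmf_bind
  by (intro measure_pmf.measure_bind[where N = "count_space UNIV"]) auto

lemma prob_attack:
  fixes P :: "('x::finite \<times> 'y::finite) pmf"
  shows "measure_pmf.prob (attack P K g) E =
    (\<Sum>x\<in>UNIV. \<Sum>y\<in>UNIV. pmf P (x, y) * measure_pmf.prob (K x) {u. (u, x, y, g y) \<in> E})"
proof -
  have "measure_pmf.prob (attack P K g) E =
      (\<integral>z. measure_pmf.prob (map_pmf (\<lambda>u. (u, fst z, snd z, g (snd z))) (K (fst z))) E \<partial>measure_pmf P)"
    by (simp add: attack_def measure_bind_pmf case_prod_unfold)
  also have "\<dots> = (\<Sum>z\<in>UNIV. pmf P z *
      measure_pmf.prob (K (fst z)) {u. (u, fst z, snd z, g (snd z)) \<in> E})"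
    by (subst integral_measure_pmf_real[where A = UNIV]) (auto simp: vimage_def mult.commute)
  finally show ?thesis
    by (simp add: sum.cartesian_product' flip: UNIV_Times_UNIV)
qed

text \<open>The joint mass is P(x, y) K(u | x) with v forced to be \<open>g y\<close>. All marginals
  in the two Markov conditions then have closed forms, and the product identities between them are
  immediate.\<close>

lemma markov_chain_attack:
  fixes P :: "('x::finite \<times> 'y::finite) pmf"
  shows "markov_chain (attack P K g)"
proof -
  let ?p = "measure_pmf.prob (attack P K g)"
  \<comment> \<open>Three rules collapse the double sum of \<open>prob_attack\<close>, according to
    whether the event fixes both x and y, only x, or only y.\<close>
  have p_xy: "?p {w. Q w} = f c b"
    if "\<And>x y. pmf P (x, y) * measure_pmf.prob (K x) {u. Q (u, x, y, g y)} =
      (if x = c \<and> y = b then f x y else 0)" for Q f c b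
  proof -
    have "?p {w. Q w} = (\<Sum>z\<in>UNIV. if z = (c, b) then f c b else 0)"
      unfolding UNIV_Times_UNIV[symmetric] sum.cartesian_product'
      by (auto simp: prob_attack that intro!: sum.cong)
    then show ?thesis by simp
  qed
  have p_x: "?p {w. Q w} = (\<Sum>y\<in>UNIV. f c y)"
    if "\<And>x y. pmf P (x, y) * measure_pmf.prob (K x) {u. Q (u, x, y, g y)} =
      (if x = c then f x y else 0)" for Q f c
    unfolding prob_attack mem_Collect_eq that by (subst sum.swap) simp
  have p_y: "?p {w. Q w} = (\<Sum>x\<in>UNIV. f x b)"
    if "\<And>x y. pmf P (x, y) * measure_pmf.prob (K x) {u. Q (u, x, y, g y)} =
      (if y = b then f x y else 0)" for Q f b
    unfolding prob_attack mem_Collect_eq that by simp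
  have uxyv: "?p {w. (case w of (u, x, y, v) \<Rightarrow> u = a \<and> x = c \<and> y = b \<and> v = d)} =
      pmf P (c, b) * pmf (K c) a * of_bool (d = g b)" for a b c d
    by (subst p_xy[where f = "\<lambda>x y. pmf P (x, y) * pmf (K x) a * of_bool (d = g y)" and c = c and b = b]) (auto simp: measure_pmf_single)
  have x: "?p {w. (case w of (u, x, y, v) \<Rightarrow> x = c)} = (\<Sum>y\<in>UNIV. pmf P (c, y))" for c
    by (subst p_x[where f = "\<lambda>x y. pmf P (x, y)" and c = c]) auto
  have ux: "?p {w. (case w of (u, x, y, v) \<Rightarrow> u = a \<and> x = c)} =
      (\<Sum>y\<in>UNIV. pmf P (c, y)) * pmf (K c) a" for a c
    by (subst p_x[where f = "\<lambda>x y. pmf P (x, y) * pmf (K x) a" and c = c])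
      (auto simp: measure_pmf_single sum_distrib_right)
  have xyv: "?p {w. (case w of (u, x, y, v) \<Rightarrow> x = c \<and> y = b \<and> v = d)} =
      pmf P (c, b) * of_bool (d = g b)" for b c d
    by (subst p_xy[where f = "\<lambda>x y. pmf P (x, y) * of_bool (d = g y)" and c = c and b = b]) auto
  have y: "?p {w. (case w of (u, x, y, v) \<Rightarrow> y = b)} = (\<Sum>x\<in>UNIV. pmf P (x, b))" for b
    by (subst p_y[where f = "\<lambda>x y. pmf P (x, y)" and b = b]) auto
  have uxy: "?p {w. (case w of (u, x, y, v) \<Rightarrow> u = a \<and> x = c \<and> y = b)} =
      pmf P (c, b) * pmf (K c) a" for a b c
    by (subst p_xy[where f = "\<lambda>x y. pmf P (x, y) * pmf (K x) a" and c = c and b = b]) (auto simp: measure_pmf_single)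
  have yv: "?p {w. (case w of (u, x, y, v) \<Rightarrow> y = b \<and> v = d)} =
      (\<Sum>x\<in>UNIV. pmf P (x, b)) * of_bool (d = g b)" for b d
    by (subst p_y[where f = "\<lambda>x y. pmf P (x, y) * of_bool (d = g y)" and b = b])
      (auto simp: sum_distrib_right)
  have "cond_indep (attack P K g) (\<lambda>(u, x, y, v). u) (\<lambda>(u, x, y, v). (y, v)) (\<lambda>(u, x, y, v). x)"
    unfolding cond_indep_iff using uxyv x ux xyv
    by (simp add: case_prod_unfold prod_eq_iff conj_ac)
  moreover
  have "cond_indep (attack P K g) (\<lambda>(u, x, y, v). (u, x)) (\<lambda>(u, x, y, v). v) (\<lambda>(u, x, y, v). y)"
    unfolding cond_indep_iff using uxyv y uxy yv
    by (simp add: case_prod_unfold prod_eq_iff conj_ac)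
  ultimately show ?thesis
    by (simp add: markov_chain_def)
qed

lemma attack_in_attack_laws:
  fixes P :: "('x::finite \<times> 'y::finite) pmf"
  assumes "\<And>x. set_pmf (K x) \<subseteq> A" and "\<And>y. g y \<in> G"
  shows "attack P K g \<in> attack_laws P A G"
proof -
  have "map_pmf (\<lambda>(u, x, y, v). (x, y)) (attack P K g) = P"
    by (simp add: attack_def map_bind_pmf case_prod_unfold map_pmf_comp map_pmf_const
        bind_return_pmf')
  moreover have "set_pmf (attack P K g) \<subseteq> A \<times> UNIV \<times> UNIV \<times> G"
    using assms(2) by (auto simp: attack_def dest: subsetD[OF assms(1)])
  ultimately show ?thesis
    by (simp add: attack_laws_def markov_chain_attack)
qed

section \<open>A secret attaining the upper bound\<close>

text \<open>Every \<open>x\<close> owns a block of \<open>k\<close> secrets. With \<open>p\<close> the least positive probability of a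
  value of \<open>X\<close>, the secret is uniform in the block of \<open>X\<close> with probability \<open>p / P(X)\<close>, so that all
  elements of blocks of possible \<open>x\<close> get the same mass \<open>p / k\<close>. The remaining mass is spread over a large pool of
  dummy secrets common to all \<open>x\<close>.\<close>

lemma shattering_kernel:
  fixes P :: "('x::finite \<times> 'y::finite) pmf" and k :: nat
  assumes "k > 0"
  obtains A :: "nat set" and \<delta> K T where "finite A" "\<delta> > 0" "\<And>x. set_pmf (K x) \<subseteq> A"
    "\<And>y. T y \<subseteq> A" "\<And>y. card (T y) = k"
    "\<And>u. pmf (bind_pmf P (\<lambda>(x, y). K x)) u \<le> \<delta>"
    "(\<Sum>x\<in>UNIV. \<Sum>y\<in>UNIV. pmf P (x, y) * measure_pmf.prob (K x) (T y)) =
       real k * \<delta> * sum_channel_max P"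
proof -
  define p where "p x = pmf (map_pmf fst P) x" for x
  define p0 where "p0 = Min (p ` set_pmf (map_pmf fst P))"
  have p0_le: "p0 \<le> p x" if "p x \<noteq> 0" for x
    unfolding p0_def using that by (intro Min_le) (auto simp: p_def set_pmf_iff simp del: set_map_pmf)
  have "p0 \<in> p ` set_pmf (map_pmf fst P)"
    unfolding p0_def by (intro Min_in) (auto simp: set_pmf_not_empty)
  then have p0: "p0 > 0"
    by (auto simp: p_def pmf_pos set_pmf_iff simp del: set_map_pmf)
  \<comment> \<open>For x outside the support of X, \<open>q x\<close> is p0 / 0 = 0, so the kernel
    at such an x draws from the dummy pool only.\<close>
  define q where "q x = p0 / p x" for x
  have p_nonneg: "p x \<ge> 0" for x by (simp add: p_def)
  have q_nonneg: "q x \<ge> 0" for x using p0 p_nonneg by (simp add: q_def)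
  have q_le: "q x \<le> 1" for x
    using p0_le[of x] p_nonneg[of x] by (cases "p x = 0") (auto simp: q_def)
  define \<delta> where "\<delta> = p0 / k"
  have \<delta>: "\<delta> > 0" using p0 assms by (simp add: \<delta>_def)
  obtain e :: "'x \<Rightarrow> nat" where e: "inj e"
    using finite_imp_inj_to_nat_seg[of "UNIV :: 'x set"] by auto
  \<comment> \<open>All blocks lie below \<open>N\<close>, where the pool starts.\<close>
  define N where "N = Suc (Max (range e)) * k"
  define B where "B x = {e x * k..<e x * k + k}" for x
  \<comment> \<open>The pool is large enough that even the whole mass spread over it gives each
    dummy at most \<open>\<delta>\<close>.\<close>
  define M where "M = nat \<lceil>1 / \<delta>\<rceil>"
  have "1 / \<delta> \<le> M" unfolding M_def by linarith
  with \<delta> have M: "M > 0" "1 / M \<le> \<delta>"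
    by (auto simp: divide_simps mult.commute intro!: Nat.gr0I split: if_splits)
  define R where "R = {N..<N + M}"
  define K where "K x = bind_pmf (bernoulli_pmf (q x))
      (\<lambda>b. if b then pmf_of_set (B x) else pmf_of_set R)" for x
  have B: "finite (B x)" "B x \<noteq> {}" "card (B x) = k" for x
    using assms by (auto simp: B_def)
  have R: "finite R" "R \<noteq> {}" "card R = M"
    using M by (auto simp: R_def)
  have B_disjoint: "x = x'" if "u \<in> B x" "u \<in> B x'" for u x x'
  proof -
    \<comment> \<open>Division by \<open>k\<close> recovers the index of the block.\<close>
    have "u div k = e z" if "u \<in> B z" for z
      using that assms unfolding B_def
      by (intro div_nat_eqI) (auto simp: algebra_simps)
    with that e show ?thesis by (metis injD)
  qed
  have BR: "u \<notin> R" if "u \<in> B x" for u x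
  proof -
    have "e x \<le> Max (range e)" by (intro Max_ge) auto
    then have "e x * k + k \<le> N"
      by (simp add: N_def)
    with that show ?thesis by (auto simp: B_def R_def)
  qed
  have K: "pmf (K x) u = q x * indicator (B x) u / k + (1 - q x) * indicator R u / M" for x u
    using q_nonneg[of x] q_le[of x] B R by (simp add: K_def pmf_bind mult.commute)
  have K_B: "measure_pmf.prob (K x) (B x') = (if x = x' then q x else 0)" for x x'
  proof -
    have "measure_pmf.prob (K x) (B x') = (\<Sum>u\<in>B x'. q x * of_bool (x = x') / k)"
      unfolding measure_measure_pmf_finite[OF B(1)] using B_disjoint BR
      by (intro sum.cong) (auto simp: K indicator_def)
    then show ?thesis using B assms by simp
  qed
  have secrets: "finite (\<Union>(range B) \<union> R)" using B R by auto
  have K_secrets: "set_pmf (K x) \<subseteq> \<Union>(range B) \<union> R" for x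
    using B R by (auto simp: K_def set_pmf_of_set[OF B(2,1)] set_pmf_of_set[OF R(2,1)] split: if_splits)
  have mass_le: "pmf (bind_pmf P (\<lambda>(x, y). K x)) u \<le> \<delta>" for u
  proof -
    have "bind_pmf P (\<lambda>(x, y). K x) = bind_pmf (map_pmf fst P) K"
      by (simp add: bind_map_pmf case_prod_unfold)
    then have U: "pmf (bind_pmf P (\<lambda>(x, y). K x)) u = (\<Sum>x\<in>UNIV. p x * pmf (K x) u)"
      unfolding p_def
      by (simp only: pmf_bind integral_measure_pmf_real[where A = UNIV] finite UNIV_I mult.commute)
    consider (block) x where "u \<in> B x" | (pool) "\<And>x. u \<notin> B x" by blast
    then show ?thesis
    proof cases
      case block
      have "p x' * pmf (K x') u = (if x' = x then p x * q x / k else 0)" for x'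
        using block BR B_disjoint by (auto simp: K indicator_def)
      then have "pmf (bind_pmf P (\<lambda>(x, y). K x)) u = p x * q x / k" by (simp add: U)
      \<comment> \<open>The product \<open>p x * q x\<close> is p0 for possible x and 0 for the
        others.\<close>
      also have "\<dots> \<le> \<delta>" using p0 by (simp add: q_def \<delta>_def)
      finally show ?thesis .
    next
      case pool
      have "p x * pmf (K x) u \<le> p x * (1 / M)" for x
        using pool q_nonneg q_le p_nonneg M
        by (intro mult_left_mono) (auto simp: K indicator_def divide_simps)
      then have "pmf (bind_pmf P (\<lambda>(x, y). K x)) u \<le> (\<Sum>x\<in>UNIV. p x * (1 / M))"
        unfolding U by (intro sum_mono)
      also have "\<dots> = 1 / M"
        by (simp add: p_def sum_pmf_eq_1 flip: sum_divide_distrib)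
      also have "\<dots> \<le> \<delta>" by (rule M)
      finally show ?thesis .
    qed
  qed
  have "\<exists>x. channel_max P y = pmf P (x, y) / p x" for y
  proof -
    have "channel_max P y \<in> range (\<lambda>x. pmf P (x, y) / p x)"
      unfolding channel_max_def p_def by (intro Max_in) auto
    then show ?thesis by auto
  qed
  then obtain xs where xs: "\<And>y. channel_max P y = pmf P (xs y, y) / p (xs y)" by metis
  \<comment> \<open>On seeing y, the block of the maximum likelihood input \<open>xs y\<close>
    contains the secret only if X = \<open>xs y\<close>, and then with probability p0 / P(X). So y
    contributes p0 times its channel maximum, and p0 is \<open>k * \<delta>\<close>.\<close>
  have "(\<Sum>x\<in>UNIV. \<Sum>y\<in>UNIV. pmf P (x, y) * measure_pmf.prob (K x) (B (xs y))) =
      (\<Sum>y\<in>UNIV. \<Sum>x\<in>UNIV. if x = xs y then pmf P (x, y) * q x else 0)"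
    by (subst sum.swap) (auto simp: K_B intro!: sum.cong)
  also have "\<dots> = (\<Sum>y\<in>UNIV. p0 * channel_max P y)"
    by (simp add: xs q_def mult.commute)
  also have "\<dots> = real k * \<delta> * sum_channel_max P"
    using assms by (simp add: sum_channel_max_def \<delta>_def sum_distrib_left)
  finally have success: "(\<Sum>x\<in>UNIV. \<Sum>y\<in>UNIV. pmf P (x, y) * measure_pmf.prob (K x) (B (xs y))) =
      real k * \<delta> * sum_channel_max P" .
  show ?thesis
    by (rule that[OF secrets \<delta> K_secrets _ B(3) mass_le success]) auto
qed

section \<open>Evaluation of both leakages\<close>

text \<open>In use, \<open>s * c\<close> is the success probability of the attack and
  \<open>m\<close> that of blind guessing, so bounding \<open>m\<close> by \<open>s\<close> takes
  the place of computing it.\<close>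

lemma le_mult_divide_if_le:
  fixes c m s :: real
  assumes "0 < m" "m \<le> s" "0 \<le> c"
  shows "c \<le> s * c / m"
  using mult_right_mono[OF assms(2,3)] assms(1) by (simp add: le_divide_eq mult.commute)

text \<open>The upper bound is \<open>attack_success_le\<close> with singletons as guessed sets; the
  attack for the lower bound comes from \<open>shattering_kernel\<close> with blocks of size
  1.\<close>

lemma maximal_leakage_eq: "maximal_leakage P = elog (sum_channel_max P)"
proof (rule antisym)
  show "maximal_leakage P \<le> elog (sum_channel_max P)"
    unfolding maximal_leakage_def
  proof (rule SUP_least, clarify, rule elog_mono)
    fix A J assume A: "finite A" and J: "J \<in> attack_laws P A A"
    let ?m = "Max ((\<lambda>u. pmf (map_pmf fst J) u) ` A)"
    have m: "pmf (map_pmf fst J) v \<le> ?m" if "v \<in> A" for v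
      using A that by (intro Max_ge) auto
    have le: "measure_pmf.prob J {(u, x, y, v). u \<in> {v}} \<le> ?m * sum_channel_max P"
      by (rule attack_success_le[OF J A A]) (auto simp: measure_pmf_single m)
    have "A \<noteq> {}"
      using J set_pmf_not_empty[of J] by (auto simp: attack_laws_def)
    then have "?m \<ge> 0" using m pmf_nonneg by (meson all_not_in_conv order_trans)
    \<comment> \<open>If \<open>?m\<close> is 0, the quotient is 0 by convention and the sum of
      channel maxima is nonnegative.\<close>
    with le show "measure_pmf.prob J {w \<in> space (measure_pmf J). case w of (u, x, y, v) \<Rightarrow> u = v} / ?m
        \<le> sum_channel_max P"
      using sum_channel_max_nonneg[of P]
      by (cases "?m = 0") (auto simp: divide_le_eq mult.commute)
  qed
next
  obtain A :: "nat set" and \<delta> K T where A: "finite A" and \<delta>: "\<delta> > 0" and K: "\<And>x. set_pmf (K x) \<subseteq> A"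
    and T: "\<And>y. T y \<subseteq> A" "\<And>y. card (T y) = 1"
    and le: "\<And>u. pmf (bind_pmf P (\<lambda>(x, y). K x)) u \<le> \<delta>"
    and sum: "(\<Sum>x\<in>UNIV. \<Sum>y\<in>UNIV. pmf P (x, y) * measure_pmf.prob (K x) (T y)) =
       real 1 * \<delta> * sum_channel_max P"
    using shattering_kernel[OF zero_less_one, of P] by blast
  have "\<exists>t. T y = {t}" for y using T(2)[of y] by (auto simp: card_1_singleton_iff)
  then obtain g where g: "\<And>y. T y = {g y}" by metis
  let ?J = "attack P K g"
  let ?m = "Max ((\<lambda>u. pmf (map_pmf fst ?J) u) ` A)"
  have J: "?J \<in> attack_laws P A A"
    using K T(1) g by (intro attack_in_attack_laws) auto
  have success: "measure_pmf.prob ?J {w \<in> space (measure_pmf ?J). case w of (u, x, y, v) \<Rightarrow> u = v}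
      = \<delta> * sum_channel_max P"
    using sum by (simp add: prob_attack g)
  obtain u where u: "u \<in> set_pmf (map_pmf fst ?J)"
    using set_pmf_not_empty[of "map_pmf fst ?J"] by blast
  moreover have "set_pmf (map_pmf fst ?J) \<subseteq> A"
    using J by (auto simp: attack_laws_def)
  ultimately have "u \<in> A" by blast
  have "0 < pmf (map_pmf fst ?J) u" using u by (rule pmf_positive)
  also have "\<dots> \<le> ?m" using A \<open>u \<in> A\<close> by (intro Max_ge) auto
  finally have "?m > 0" .
  moreover have "?m \<le> \<delta>"
    using A \<open>u \<in> A\<close> le by (subst Max_le_iff) (auto simp: map_fst_attack)
  ultimately have "sum_channel_max P \<le> \<delta> * sum_channel_max P / ?m"
    using sum_channel_max_nonneg by (rule le_mult_divide_if_le)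
  then have "elog (sum_channel_max P) \<le> elog (measure_pmf.prob ?J
      {w \<in> space (measure_pmf ?J). case w of (u, x, y, v) \<Rightarrow> u = v} / ?m)"
    unfolding success by (rule elog_mono)
  then show "elog (sum_channel_max P) \<le> maximal_leakage P"
    unfolding maximal_leakage_def using A J
    by (intro SUP_upper2[where i = "(A, ?J)"]) auto
qed

text \<open>A tuple of \<open>k\<close> guesses covers at most \<open>k\<close> values, so its image
  competes in the maximum of the denominator. Conversely, a block of size \<open>k\<close> is
  covered exactly by \<open>k\<close> guesses.\<close>

lemma k_maximal_leakage_eq:
  assumes "k > 0"
  shows "k_maximal_leakage k P = elog (sum_channel_max P)"
proof (rule antisym)
  show "k_maximal_leakage k P \<le> elog (sum_channel_max P)"
    unfolding k_maximal_leakage_def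
  proof (rule SUP_least, clarify, rule elog_mono)
    fix A :: "nat set" and J assume A: "finite A" and J: "J \<in> attack_laws P A ({1..k} \<rightarrow>\<^sub>E A)"
    let ?m = "Max ((\<lambda>S. measure_pmf.prob (map_pmf fst J) S) ` {S. S \<subseteq> A \<and> card S \<le> k})"
    have m: "measure_pmf.prob (map_pmf fst J) S \<le> ?m" if "S \<subseteq> A" "card S \<le> k" for S
      using A that by (intro Max_ge) auto
    have le: "measure_pmf.prob J {(u, x, y, v). u \<in> v ` {1..k}} \<le> ?m * sum_channel_max P"
    proof (rule attack_success_le[OF J A])
      show "finite ({1..k} \<rightarrow>\<^sub>E A)" using A by (intro finite_PiE) auto
      show "measure_pmf.prob (map_pmf fst J) (v ` {1..k}) \<le> ?m" if "v \<in> {1..k} \<rightarrow>\<^sub>E A" for v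
        using that card_image_le[of "{1..k}" v] by (intro m) auto
    qed auto
    have "?m \<ge> 0" using m[of "{}"] by simp
    moreover have "{(u, x :: 'a, y :: 'b, v). u \<in> v ` {1..k}} =
        {w \<in> space (measure_pmf J). case w of (u, x, y, v) \<Rightarrow> \<exists>i\<in>{1..k}. u = v i}"
      by auto
    ultimately show "measure_pmf.prob J
          {w \<in> space (measure_pmf J). case w of (u, x, y, v) \<Rightarrow> \<exists>i\<in>{1..k}. u = v i} / ?m
        \<le> sum_channel_max P"
      using le sum_channel_max_nonneg[of P]
      by (cases "?m = 0") (auto simp: divide_le_eq mult.commute)
  qed
next
  obtain A :: "nat set" and \<delta> K T where A: "finite A" and \<delta>: "\<delta> > 0" and K: "\<And>x. set_pmf (K x) \<subseteq> A"
    and T: "\<And>y. T y \<subseteq> A" "\<And>y. card (T y) = k"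
    and le: "\<And>u. pmf (bind_pmf P (\<lambda>(x, y). K x)) u \<le> \<delta>"
    and sum: "(\<Sum>x\<in>UNIV. \<Sum>y\<in>UNIV. pmf P (x, y) * measure_pmf.prob (K x) (T y)) =
       real k * \<delta> * sum_channel_max P"
    using shattering_kernel[OF assms, of P] by blast
  have "\<exists>h. h ` {1..k} = T y \<and> h \<in> {1..k} \<rightarrow>\<^sub>E A" for y
  proof -
    have "finite (T y)" using T(1) A by (rule finite_subset)
    from ex_bij_betw_nat_finite_1[OF this] obtain h where h: "h ` {1..k} = T y"
      using T(2) by (auto simp: bij_betw_def)
    with T(1) show ?thesis
      \<comment> \<open>Restriction makes the enumeration undefined off \<open>{1..k}\<close>, as
        membership in the extensional function space demands.\<close>
      by (intro exI[of _ "restrict h {1..k}"]) auto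
  qed
  then obtain g where g: "\<And>y. g y ` {1..k} = T y" "\<And>y. g y \<in> {1..k} \<rightarrow>\<^sub>E A" by metis
  let ?J = "attack P K g"
  let ?m = "Max ((\<lambda>S. measure_pmf.prob (map_pmf fst ?J) S) ` {S. S \<subseteq> A \<and> card S \<le> k})"
  have J: "?J \<in> attack_laws P A ({1..k} \<rightarrow>\<^sub>E A)"
    using K g(2) by (intro attack_in_attack_laws) auto
  have "{u. \<exists>i\<in>{1..k}. u = g y i} = T y" for y
    using g(1)[of y] by auto
  then have success: "measure_pmf.prob ?J
      {w \<in> space (measure_pmf ?J). case w of (u, x, y, v) \<Rightarrow> \<exists>i\<in>{1..k}. u = v i}
      = real k * \<delta> * sum_channel_max P"
    using sum by (simp add: prob_attack)
  obtain u where u: "u \<in> set_pmf (map_pmf fst ?J)"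
    using set_pmf_not_empty[of "map_pmf fst ?J"] by blast
  moreover have "set_pmf (map_pmf fst ?J) \<subseteq> A"
    using J by (auto simp: attack_laws_def)
  ultimately have "u \<in> A" by blast
  have "0 < pmf (map_pmf fst ?J) u" using u by (rule pmf_positive)
  also have "\<dots> = measure_pmf.prob (map_pmf fst ?J) {u}" by (rule measure_pmf_single[symmetric])
  also have "\<dots> \<le> ?m" using A \<open>u \<in> A\<close> assms by (intro Max_ge) auto
  finally have "?m > 0" .
  \<comment> \<open>Every value of the secret has mass at most \<open>\<delta>\<close>, so
    \<open>k\<close> blind guesses gain at most \<open>k * \<delta>\<close>, the factor in the
    success probability.\<close>
  moreover have "?m \<le> real k * \<delta>"
  proof (subst Max_le_iff)
    show "\<forall>r\<in>(\<lambda>S. measure_pmf.prob (map_pmf fst ?J) S) ` {S. S \<subseteq> A \<and> card S \<le> k}. r \<le> real k * \<delta>"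
    proof clarify
      fix S assume S: "S \<subseteq> A" "card S \<le> k"
      then have "finite S" using A finite_subset by blast
      then have "measure_pmf.prob (map_pmf fst ?J) S = (\<Sum>u\<in>S. pmf (map_pmf fst ?J) u)"
        by (rule measure_measure_pmf_finite)
      also have "\<dots> \<le> real (card S) * \<delta>"
        using le by (intro sum_bounded_above) (simp add: map_fst_attack)
      also have "\<dots> \<le> real k * \<delta>" using S \<delta> by (intro mult_right_mono) auto
      finally show "measure_pmf.prob (map_pmf fst ?J) S \<le> real k * \<delta>" .
    qed
  qed (use A in auto)
  ultimately have "sum_channel_max P \<le> real k * \<delta> * sum_channel_max P / ?m"
    using sum_channel_max_nonneg by (rule le_mult_divide_if_le)
  then have "elog (sum_channel_max P) \<le> elog (measure_pmf.prob ?J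
      {w \<in> space (measure_pmf ?J). case w of (u, x, y, v) \<Rightarrow> \<exists>i\<in>{1..k}. u = v i} / ?m)"
    unfolding success by (rule elog_mono)
  then show "elog (sum_channel_max P) \<le> k_maximal_leakage k P"
    unfolding k_maximal_leakage_def using A J
    by (intro SUP_upper2[where i = "(A, ?J)"]) auto
qed

theorem theorem4:
  fixes P :: "('x::finite \<times> 'y::finite) pmf" and k :: nat
  assumes "k > 0"
  shows "k_maximal_leakage k P = maximal_leakage P"
  by (simp add: k_maximal_leakage_eq[OF assms] maximal_leakage_eq)

end
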